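(* Let $\Gamma$ be a nonempty collection of sets which is a down set, let $V=V(\Gamma):=\bigcup_{A\in\Gamma}A$, and suppose that $V\notin\Gamma$. Then $$I^{*}(\Gamma)=\hat I(\Gamma),$$ where $I^{*}(\Gamma)$ is the collection of all sets $S$ such that $S\cup B\in\Gamma$ for every $B\in\Gamma$, and $\hat I(\Gamma)$ is the intersection of all $\Gamma$-maximal ideals.
   Context: A collection of sets $A$ is a down set if $B\in A$ and $C\subseteq B$ imply $C\in A$. A collection $I$ of subsets of a set $X$ is an ideal on $X$ if: (i) $I$ is a down set; (ii) $B\cup C\in I$ for all $B,C\in I$; (iii) $X\notin I$. For a collection of sets $\Gamma$ with $V=V(\Gamma):=\bigcup_{A\in\Gamma}A$, an ideal $I$ on $V$ is called $\Gamma$-maximal if $I\subseteq\Gamma$ and, for every ideal $J$ on $V$, $I\subseteq J\subseteq\Gamma$ implies $I=J$. $M(\Gamma)$ is the set of all $\Gamma$-maximal ideals and $\hat I(\Gamma):=\bigcap_{I\in M(\Gamma)}I$. *)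

theory Defs
  imports Main
begin

definition down_set :: "'a set set \<Rightarrow> bool" where
  "down_set A \<longleftrightarrow> (\<forall>B C. B \<in> A \<and> C \<subseteq> B \<longrightarrow> C \<in> A)"

text \<open>
  An ideal is not required to be nonempty: the empty collection is vacuously an ideal.
\<close>

definition ideal_on :: "'a set \<Rightarrow> 'a set set \<Rightarrow> bool" where
  "ideal_on X I \<longleftrightarrow>
     I \<subseteq> Pow X \<and> down_set I \<and> (\<forall>B\<in>I. \<forall>C\<in>I. B \<union> C \<in> I) \<and> X \<notin> I"

definition maximal_ideal :: "'a set set \<Rightarrow> 'a set set \<Rightarrow> bool" where
  "maximal_ideal \<Gamma> I \<longleftrightarrow>
     ideal_on (\<Union>\<Gamma>) I \<and> I \<subseteq> \<Gamma> \<and>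
     (\<forall>J. ideal_on (\<Union>\<Gamma>) J \<and> I \<subseteq> J \<and> J \<subseteq> \<Gamma> \<longrightarrow> I = J)"

definition maximal_ideals :: "'a set set \<Rightarrow> 'a set set set" where
  "maximal_ideals \<Gamma> = {I. maximal_ideal \<Gamma> I}"

definition I_hat :: "'a set set \<Rightarrow> 'a set set" where
  "I_hat \<Gamma> = (\<Inter>I\<in>maximal_ideals \<Gamma>. I)"

text \<open>
  \<open>S\<close> ranges over all sets of elements of the ambient type, not only over subsets of
  \<open>\<Union>\<Gamma>\<close>.
\<close>

definition I_star :: "'a set set \<Rightarrow> 'a set set" where
  "I_star \<Gamma> = {S. \<forall>B\<in>\<Gamma>. S \<union> B \<in> \<Gamma>}"

end

theory Submission
  imports Defs
begin

text \<open>
  Adjoining some \<open>S \<in> I_star \<Gamma>\<close> to a \<open>\<Gamma>\<close>-maximal ideal generates an ideal that is still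
  contained in \<open>\<Gamma>\<close>, so \<open>S\<close> already belongs to it. Conversely, for \<open>B \<in> \<Gamma>\<close> the ideal
  \<open>Pow B\<close> extends to a \<open>\<Gamma>\<close>-maximal ideal by Zorn's lemma; a member \<open>S\<close> of all maximal
  ideals lies in that one, and hence so does \<open>S \<union> B\<close>.
\<close>

lemma ideal_on_Pow:
  assumes "B \<subset> X"
  shows "ideal_on X (Pow B)"
  using assms by (auto simp: ideal_on_def down_set_def)

text \<open>Supplies the upper bounds for Zorn's lemma. Closure under unions is where comparability
  enters: two members of \<open>\<Union>C\<close> lie together in the larger of two ideals of the
  chain.\<close>

lemma ideal_on_Union_chain:
  assumes ideals: "\<And>I. I \<in> C \<Longrightarrow> ideal_on X I"
    and chain: "\<And>I J. I \<in> C \<Longrightarrow> J \<in> C \<Longrightarrow> I \<subseteq> J \<or> J \<subseteq> I"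
  shows "ideal_on X (\<Union>C)"
  unfolding ideal_on_def
proof (intro conjI ballI)
  show "\<Union>C \<subseteq> Pow X" "X \<notin> \<Union>C"
    using ideals unfolding ideal_on_def by blast+
  show "down_set (\<Union>C)"
    using ideals unfolding ideal_on_def down_set_def by blast
next
  fix S T assume "S \<in> \<Union>C" "T \<in> \<Union>C"
  then obtain I J where IJ: "I \<in> C" "J \<in> C" "S \<in> I" "T \<in> J"
    by blast
  then obtain K where "K \<in> C" "S \<in> K" "T \<in> K"
    using chain[of I J] by blast
  then show "S \<union> T \<in> \<Union>C"
    using ideals unfolding ideal_on_def by blast
qed

lemma maximal_ideal_extension:
  assumes "ideal_on (\<Union>\<Gamma>) I" "I \<subseteq> \<Gamma>"
  obtains M where "maximal_ideal \<Gamma> M" "I \<subseteq> M"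
proof -
  let ?A = "{J. ideal_on (\<Union>\<Gamma>) J \<and> J \<subseteq> \<Gamma> \<and> I \<subseteq> J}"
  have "\<exists>M\<in>?A. \<forall>J\<in>?A. M \<subseteq> J \<longrightarrow> J = M"
  \<comment> \<open>Chains are taken nonempty because the union of the empty chain,
    \<open>{}\<close>, need not contain \<open>I\<close>.\<close>
  proof (rule subset_Zorn_nonempty)
    show "?A \<noteq> {}"
      using assms by blast
  next
    fix C assume "C \<noteq> {}" and C: "subset.chain ?A C"
    have "ideal_on (\<Union>\<Gamma>) (\<Union>C)"
      using C by (intro ideal_on_Union_chain) (auto simp: subset_chain_def)
    with C \<open>C \<noteq> {}\<close> show "\<Union>C \<in> ?A"
      by (fastforce simp: subset_chain_def)
  qed
  then obtain M where M: "M \<in> ?A" and max: "\<forall>J\<in>?A. M \<subseteq> J \<longrightarrow> J = M"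
    by (elim bexE)
  show thesis
  proof
    show "I \<subseteq> M"
      using M by simp
    show "maximal_ideal \<Gamma> M"
      unfolding maximal_ideal_def
    proof (intro conjI allI impI)
      show "ideal_on (\<Union>\<Gamma>) M" "M \<subseteq> \<Gamma>"
        using M by simp_all
    next
      fix J assume "ideal_on (\<Union>\<Gamma>) J \<and> M \<subseteq> J \<and> J \<subseteq> \<Gamma>"
      then have J: "ideal_on (\<Union>\<Gamma>) J" "M \<subseteq> J" "J \<subseteq> \<Gamma>"
        by simp_all
      \<comment> \<open>Zorn gives maximality only among ideals above \<open>I\<close>; every
        competitor above \<open>M\<close> is one of these.\<close>
      moreover have "I \<subseteq> J"
        using M J(2) by auto
      ultimately have "J \<in> ?A"
        by simp
      with max J(2) show "M = J"
        by metis
    qed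
  qed
qed

lemma I_star_subset_maximal_ideal:
  assumes "\<Gamma> \<noteq> {}" "down_set \<Gamma>" "\<Union>\<Gamma> \<notin> \<Gamma>" and M: "maximal_ideal \<Gamma> M"
  shows "I_star \<Gamma> \<subseteq> M"
proof
  fix S assume S: "S \<in> I_star \<Gamma>"
  \<comment> \<open>\<open>{}\<close> is inserted because \<open>M\<close> is not yet known to be nonempty.\<close>
  define J where "J = {T. \<exists>B\<in>insert {} M. T \<subseteq> S \<union> B}"
  have M_sub: "M \<subseteq> \<Gamma>" and M_union: "\<And>B C. B \<in> M \<Longrightarrow> C \<in> M \<Longrightarrow> B \<union> C \<in> M"
    using M by (auto simp: maximal_ideal_def ideal_on_def)
  \<comment> \<open>Needed for the case \<open>B = {}\<close> below, where it puts \<open>S\<close>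
    itself into \<open>\<Gamma>\<close>.\<close>
  have "{} \<in> \<Gamma>"
    using assms(1,2) unfolding down_set_def by blast
  then have "S \<union> B \<in> \<Gamma>" if "B \<in> insert {} M" for B
    using S M_sub that unfolding I_star_def by blast
  then have J_sub: "J \<subseteq> \<Gamma>"
    using assms(2) unfolding J_def down_set_def by blast
  have "ideal_on (\<Union>\<Gamma>) J"
    unfolding ideal_on_def
  proof (intro conjI ballI)
    \<comment> \<open>Properness is inherited from \<open>\<Gamma>\<close>, which omits its own
      union.\<close>
    show "J \<subseteq> Pow (\<Union>\<Gamma>)" "\<Union>\<Gamma> \<notin> J"
      using J_sub assms(3) by blast+
    show "down_set J"
      unfolding J_def down_set_def by blast
  next
    fix T U assume "T \<in> J" "U \<in> J"
    then obtain B C where BC: "B \<in> insert {} M" "C \<in> insert {} M"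
      and sub: "T \<subseteq> S \<union> B" "U \<subseteq> S \<union> C"
      unfolding J_def by blast
    have "B \<union> C \<in> insert {} M"
      using BC M_union by auto
    moreover have "T \<union> U \<subseteq> S \<union> (B \<union> C)"
      using sub by blast
    ultimately show "T \<union> U \<in> J"
      unfolding J_def by blast
  qed
  \<comment> \<open>For \<open>S\<close> the witness is \<open>B = {}\<close>. Maximality then
    forces \<open>M = J\<close>.\<close>
  moreover have "M \<subseteq> J" "S \<in> J"
    unfolding J_def by blast+
  ultimately show "S \<in> M"
    using M J_sub unfolding maximal_ideal_def by blast
qed

theorem theorem4p4:
  fixes \<Gamma> :: "'a set set"
  assumes "\<Gamma> \<noteq> {}"
    and "down_set \<Gamma>"
    and "\<Union>\<Gamma> \<notin> \<Gamma>"
  shows "I_star \<Gamma> = I_hat \<Gamma>"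
proof
  show "I_star \<Gamma> \<subseteq> I_hat \<Gamma>"
    using I_star_subset_maximal_ideal[OF assms]
    by (auto simp: I_hat_def maximal_ideals_def)
next
  show "I_hat \<Gamma> \<subseteq> I_star \<Gamma>"
    unfolding I_star_def
  proof (intro subsetI CollectI ballI)
    fix S B assume S: "S \<in> I_hat \<Gamma>" and B: "B \<in> \<Gamma>"
    \<comment> \<open>Strictness is what makes \<open>Pow B\<close> a proper ideal.\<close>
    have "B \<subset> \<Union>\<Gamma>"
      using B assms(3) by auto
    moreover have "Pow B \<subseteq> \<Gamma>"
      using B assms(2) by (auto simp: down_set_def)
    ultimately obtain M where M: "maximal_ideal \<Gamma> M" "Pow B \<subseteq> M"
      by (rule maximal_ideal_extension[OF ideal_on_Pow])
    have "S \<in> M"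
      using S M(1) by (auto simp: I_hat_def maximal_ideals_def)
    moreover have "B \<in> M"
      using M(2) by auto
    ultimately have "S \<union> B \<in> M"
      using M(1) by (auto simp: maximal_ideal_def ideal_on_def)
    with M(1) show "S \<union> B \<in> \<Gamma>"
      by (auto simp: maximal_ideal_def)
  qed
qed

end
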